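(* Let $T$ be a left continuous t-norm on $[0,1]$ and $L$ be a right continuous t-conorm on $[0,\infty]$. Then $L\otimes T(f,g)\in\mathcal{D}^+$ for all $f,g\in\mathcal{D}^+$ if and only if $L$ has no zero divisor, i.e. for all $x,y\in[0,\infty]$, $L(x,y)=\infty$ implies $x=\infty$ or $y=\infty$. In this case, $(\mathcal{D}^+,L\otimes T)$ is a submonoid of $(\Delta^+,L\otimes T)$.
   Context: A distance distribution function (d.d.f.) is an increasing (i.e. non-decreasing) function $f:[0,\infty]\to[0,1]$ with $f(0)=0$, $f(\infty)=1$ that is left continuous on the open interval $]0,\infty[$. $\Delta^+$ is the set of all d.d.f.'s, ordered pointwise; it is a complete lattice in which suprema of non-empty families are computed pointwise. $\mathcal{D}^+\subseteq\Delta^+$ is the set of all non-defective d.d.f.'s, i.e. those with $f(\infty^-)=\sup_{x<\infty}f(x)=1$. For $r\in[0,\infty]$, $p\in[0,1]$, the step function $\varepsilon(r,p)\in\Delta^+$ is given by $\varepsilon(r,p)(\infty)=1$, $\varepsilon(r,p)(x)=p$ for $r<x<\infty$, and $\varepsilon(r,p)(x)=0$ for $x\le r$, $x<\infty$. A t-norm $T$ is an associative, commutative binary operation on $[0,1]$, increasing in each place, with identity $1$; it is left continuous if it is left continuous as a function $[0,1]^2\to[0,1]$ (equivalently, it preserves arbitrary suprema in each variable). A t-conorm $L$ on $[0,\infty]$ is an associative, commutative binary operation on $[0,\infty]$, increasing in each place, with identity $0$; it is right continuous if it is right continuous as a function $[0,\infty]^2\to[0,\infty]$ (equivalently, it preserves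 arbitrary infima in each variable). $L\otimes T$ is the binary operation on $\Delta^+$ that preserves arbitrary suprema in each variable and satisfies $L\otimes T(\varepsilon(r,p),\varepsilon(s,q))=\varepsilon(L(r,s),T(p,q))$ for all $r,s,p,q$; equivalently $L\otimes T(f,g)=\sup_{r,s\in[0,\infty]}\varepsilon(L(r,s),T(f(r),g(s)))$ (supremum in $\Delta^+$). $(\Delta^+,L\otimes T)$ is a commutative monoid with identity $\varepsilon(0,1)$. *)

theory Defs
  imports "HOL-Analysis.Analysis" "HOL-Algebra.Group"
begin

definition Delta_plus :: "(ennreal \<Rightarrow> real) set" where
  "Delta_plus = {f. (\<forall>x. f x \<in> {0..1}) \<and> mono f \<and> f 0 = 0 \<and> f \<infinity> = 1 \<and>
     (\<forall>x. 0 < x \<and> x < \<infinity> \<longrightarrow> continuous (at_left x) f)}"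

definition D_plus :: "(ennreal \<Rightarrow> real) set" where
  "D_plus = {f \<in> Delta_plus. (SUP x\<in>{..<\<infinity>}. f x) = 1}"

definition step :: "ennreal \<Rightarrow> real \<Rightarrow> ennreal \<Rightarrow> real" where
  "step r p x = (if x = \<infinity> then 1 else if r < x then p else 0)"

definition t_norm :: "(real \<Rightarrow> real \<Rightarrow> real) \<Rightarrow> bool" where
  "t_norm T \<longleftrightarrow>
     (\<forall>x\<in>{0..1}. \<forall>y\<in>{0..1}. T x y \<in> {0..1}) \<and>
     (\<forall>x\<in>{0..1}. \<forall>y\<in>{0..1}. \<forall>z\<in>{0..1}. T (T x y) z = T x (T y z)) \<and>
     (\<forall>x\<in>{0..1}. \<forall>y\<in>{0..1}. T x y = T y x) \<and>
     (\<forall>x\<in>{0..1}. \<forall>y\<in>{0..1}. \<forall>z\<in>{0..1}. x \<le> y \<longrightarrow> T x z \<le> T y z \<and> T z x \<le> T z y) \<and>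
     (\<forall>x\<in>{0..1}. T x 1 = x \<and> T 1 x = x)"

text \<open>Left continuity as a function of two variables: at each point, along arguments that are
  componentwise below it.\<close>

definition left_continuous_t_norm :: "(real \<Rightarrow> real \<Rightarrow> real) \<Rightarrow> bool" where
  "left_continuous_t_norm T \<longleftrightarrow> t_norm T \<and>
     (\<forall>x\<in>{0..1}. \<forall>y\<in>{0..1}. continuous (at (x, y) within {0..x} \<times> {0..y}) (\<lambda>(a, b). T a b))"

definition t_conorm :: "(ennreal \<Rightarrow> ennreal \<Rightarrow> ennreal) \<Rightarrow> bool" where
  "t_conorm L \<longleftrightarrow>
     (\<forall>x y z. L (L x y) z = L x (L y z)) \<and>
     (\<forall>x y. L x y = L y x) \<and>
     (\<forall>x y z. x \<le> y \<longrightarrow> L x z \<le> L y z \<and> L z x \<le> L z y) \<and>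
     (\<forall>x. L x 0 = x \<and> L 0 x = x)"

definition right_continuous_t_conorm :: "(ennreal \<Rightarrow> ennreal \<Rightarrow> ennreal) \<Rightarrow> bool" where
  "right_continuous_t_conorm L \<longleftrightarrow> t_conorm L \<and>
     (\<forall>x y. continuous (at (x, y) within {x..} \<times> {y..}) (\<lambda>(a, b). L a b))"

text \<open>The supremum is taken in \<open>Delta_plus\<close>, where suprema of nonempty families are pointwise.
  The lemmas \<open>tensor_lub\<close>, \<open>tensor_step\<close>, \<open>tensor_SUP\<close>, \<open>tensor_bottom\<close> and
  \<open>tensor_commute\<close> below show that \<open>tensor L T f g\<close> is the least upper bound of these step
  functions in \<open>Delta_plus\<close>, and that \<open>tensor L T\<close> preserves suprema in each variable and maps
  pairs of step functions as it should.\<close>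

definition tensor ::
  "(ennreal \<Rightarrow> ennreal \<Rightarrow> ennreal) \<Rightarrow> (real \<Rightarrow> real \<Rightarrow> real) \<Rightarrow>
   (ennreal \<Rightarrow> real) \<Rightarrow> (ennreal \<Rightarrow> real) \<Rightarrow> ennreal \<Rightarrow> real" where
  "tensor L T f g = (\<lambda>x. SUP (r, s). step (L r s) (T (f r) (g s)) x)"

text \<open>The locale \<open>submonoid\<close> does not itself require the ambient structure to be a monoid; that is
  \<open>Delta_monoid_comm_monoid\<close> below.\<close>

definition Delta_monoid ::
  "(ennreal \<Rightarrow> ennreal \<Rightarrow> ennreal) \<Rightarrow> (real \<Rightarrow> real \<Rightarrow> real) \<Rightarrow> (ennreal \<Rightarrow> real) monoid" where
  "Delta_monoid L T =
     \<lparr>carrier = Delta_plus, mult = tensor L T, one = step 0 1\<rparr>"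


subsection \<open>Adequacy of the definitions\<close>

lemma Delta_plusI:
  assumes "\<And>x. f x \<in> {0..1}" "mono f" "f 0 = 0" "f \<infinity> = 1"
    and "\<And>x c. 0 < x \<Longrightarrow> x < \<infinity> \<Longrightarrow> 0 \<le> c \<Longrightarrow> c < f x \<Longrightarrow> \<exists>y<x. c < f y"
  shows "f \<in> Delta_plus"
proof -
  have "(f \<longlongrightarrow> f x) (at_left x)" if x: "0 < x" "x < \<infinity>" for x
  proof (rule order_tendstoI)
    fix a assume a: "a < f x"
    show "\<forall>\<^sub>F y in at_left x. a < f y"
    proof (cases "a < 0")
      case True
      then have "\<And>y. a < f y" using assms(1) by (meson atLeastAtMost_iff less_le_trans)
      then show ?thesis by simp
    next
      case False
      then obtain y where y: "y < x" "a < f y" using assms(5)[of x a] x a by force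
      show ?thesis
      proof (rule eventually_at_leftI[OF _ y(1)])
        fix z assume "z \<in> {y<..<x}"
        then have "f y \<le> f z" using assms(2) by (auto intro!: monoD[of f])
        then show "a < f z" using y by simp
      qed
    qed
  next
    fix a assume a: "f x < a"
    have "f y < a" if "y \<in> {0<..<x}" for y
      using that a monoD[OF assms(2), of y x] less_imp_le[of y x] by simp
    then show "\<forall>\<^sub>F y in at_left x. f y < a" by (rule eventually_at_leftI[OF _ x(1)])
  qed
  then show ?thesis using assms(1-4) by (auto simp: Delta_plus_def continuous_within)
qed

lemma Delta_plusD:
  assumes "f \<in> Delta_plus"
  shows "0 \<le> f x" "f x \<le> 1" "x \<le> y \<Longrightarrow> f x \<le> f y" "f 0 = 0" "f \<infinity> = 1"
  using assms by (auto simp: Delta_plus_def mono_def)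

lemma Delta_plus_left:
  assumes f: "f \<in> Delta_plus" and x: "x < \<infinity>" and c: "0 \<le> c" "c < f x"
  shows "\<exists>y<x. c < f y"
proof -
  have "x \<noteq> 0" using c Delta_plusD(4)[OF f] by auto
  then have x0: "0 < x" by (simp add: zero_less_iff_neq_zero)
  then have "(f \<longlongrightarrow> f x) (at_left x)"
    using f x by (auto simp: Delta_plus_def continuous_within)
  then have "\<forall>\<^sub>F y in at_left x. c < f y" using c(2) by (rule order_tendstoD)
  then obtain b where b: "b < x" "\<And>y. b < y \<Longrightarrow> y < x \<Longrightarrow> c < f y"
    using eventually_at_left[OF x0] by metis
  obtain y where "b < y" "y < x" using dense[OF b(1)] by blast
  then show ?thesis using b by blast
qed

lemma step_in_Delta_plus:
  assumes "p \<in> {0..1}"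
  shows "step r p \<in> Delta_plus"
proof (rule Delta_plusI)
  show "mono (step r p)" using assms
    by (auto simp: mono_def step_def dest: less_le_trans simp: top_unique)
  fix x :: ennreal and c :: real assume x: "0 < x" "x < \<infinity>" and c: "0 \<le> (c::real)" "c < step r p x"
  then have "r < x" "c < p" by (auto simp: step_def split: if_splits)
  then obtain y where y: "r < y" "y < x" using dense by blast
  then have "c < step r p y" using \<open>c < p\<close> assms by (auto simp: step_def)
  then show "\<exists>y<x. c < step r p y" using y by blast
qed (use assms in \<open>auto simp: step_def\<close>)

lemma t_normD:
  assumes "t_norm T" "x \<in> {0..1}" "y \<in> {0..1}"
  shows "T x y \<in> {0..1}" "T x y = T y x" "T x 1 = x" "T 1 x = x"
    "x' \<in> {0..1} \<Longrightarrow> x \<le> x' \<Longrightarrow> T x y \<le> T x' y"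
    "y' \<in> {0..1} \<Longrightarrow> y \<le> y' \<Longrightarrow> T x y \<le> T x y'"
    "z \<in> {0..1} \<Longrightarrow> T (T x y) z = T x (T y z)"
proof -
  from assms(1) have
    1: "\<forall>x\<in>{0..1}. \<forall>y\<in>{0..1}. T x y \<in> {0..1}" and
    2: "\<forall>x\<in>{0..1}. \<forall>y\<in>{0..1}. \<forall>z\<in>{0..1}. T (T x y) z = T x (T y z)" and
    3: "\<forall>x\<in>{0..1}. \<forall>y\<in>{0..1}. T x y = T y x" and
    4: "\<forall>x\<in>{0..1}. \<forall>y\<in>{0..1}. \<forall>z\<in>{0..1}. x \<le> y \<longrightarrow> T x z \<le> T y z \<and> T z x \<le> T z y" and
    5: "\<forall>x\<in>{0..1}. T x 1 = x \<and> T 1 x = x"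
    unfolding t_norm_def by blast+
  show "T x y \<in> {0..1}" using 1 assms(2,3) by blast
  show "T x y = T y x" using 3 assms(2,3) by blast
  show "T x 1 = x" "T 1 x = x" using 5 assms(2) by blast+
  show "T x y \<le> T x' y" if "x' \<in> {0..1}" "x \<le> x'" using 4 assms(2,3) that by blast
  show "T x y \<le> T x y'" if "y' \<in> {0..1}" "y \<le> y'" using 4 assms(2,3) that by blast
  show "T (T x y) z = T x (T y z)" if "z \<in> {0..1}" using 2 assms(2,3) that by blast
qed

lemma t_norm_0:
  assumes "t_norm T" "x \<in> {0..1}"
  shows "T x 0 = 0" "T 0 x = 0"
proof -
  have "T 0 x \<le> T 0 1" "T 0 1 = 0" "0 \<le> T 0 x"
    using t_normD(1,3)[OF assms(1), of 0 x] t_normD(6)[OF assms(1), of 0 x 1] assms by auto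
  then show "T 0 x = 0" by simp
  then show "T x 0 = 0" using t_normD(2)[OF assms(1), of 0 x] assms by auto
qed

lemma t_norm_left:
  assumes T: "left_continuous_t_norm T" and x: "x \<in> {0..1}" and y: "y \<in> {0..1}"
    and c: "0 \<le> c" "c < T x y"
  shows "\<exists>d. 0 \<le> d \<and> d < x \<and> c < T d y"
proof -
  have Tn: "t_norm T" using T by (simp add: left_continuous_t_norm_def)
  have x0: "0 < x" using c t_norm_0(2)[OF Tn y] x by (cases "x = 0") auto
  have "((\<lambda>(a, b). T a b) \<longlongrightarrow> T x y) (at (x, y) within {0..x} \<times> {0..y})"
    using T x y by (auto simp: left_continuous_t_norm_def continuous_within)
  then have "\<forall>\<^sub>F p in at (x, y) within {0..x} \<times> {0..y}. c < (case p of (a, b) \<Rightarrow> T a b)"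
    using c(2) by (rule order_tendstoD)
  then obtain e where e: "e > 0"
    "\<And>p. p \<in> {0..x} \<times> {0..y} \<Longrightarrow> p \<noteq> (x, y) \<Longrightarrow> dist p (x, y) < e \<Longrightarrow> c < (case p of (a, b) \<Rightarrow> T a b)"
    unfolding eventually_at by metis
  define d where "d = max 0 (x - e / 2)"
  have d: "0 \<le> d" "d < x" "dist d x < e" using x0 e(1) by (auto simp: d_def dist_real_def)
  have "c < T d y" using e(2)[of "(d, y)"] d y by (auto simp: dist_Pair_Pair)
  then show ?thesis using d by blast
qed

lemma t_conormD:
  assumes "t_conorm L"
  shows "L (L x y) z = L x (L y z)" "L x y = L y x" "L x 0 = x" "L 0 x = x"
    "x \<le> x' \<Longrightarrow> L x y \<le> L x' y" "y \<le> y' \<Longrightarrow> L x y \<le> L x y'"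
proof -
  note * = assms[unfolded t_conorm_def]
  note 1 = *[THEN conjunct1]
  note 2 = *[THEN conjunct2, THEN conjunct1]
  note 3 = *[THEN conjunct2, THEN conjunct2, THEN conjunct1]
  note 4 = *[THEN conjunct2, THEN conjunct2, THEN conjunct2]
  show "L (L x y) z = L x (L y z)" by (rule 1[rule_format])
  show "L x y = L y x" by (rule 2[rule_format])
  show "L x 0 = x" "L 0 x = x" using 4 by simp_all
  show "L x y \<le> L x' y" if "x \<le> x'" using 3 that by blast
  show "L x y \<le> L x y'" if "y \<le> y'" using 3 that by blast
qed

lemma t_conorm_ge:
  assumes "t_conorm L"
  shows "x \<le> L x y" "y \<le> L x y"
  using t_conormD(6)[OF assms, of 0 y x] t_conormD(5)[OF assms, of 0 x y] t_conormD(3,4)[OF assms]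
  by simp_all

lemma t_conorm_right:
  assumes L: "right_continuous_t_conorm L" and c: "L x y < c"
  shows "\<exists>t>x. L t y < c"
proof -
  have Ln: "t_conorm L" using L by (simp add: right_continuous_t_conorm_def)
  have xc: "x < c" using t_conorm_ge(1)[OF Ln, of x y] c by simp
  have "((\<lambda>(a, b). L a b) \<longlongrightarrow> L x y) (at (x, y) within {x..} \<times> {y..})"
    using L by (auto simp: right_continuous_t_conorm_def continuous_within)
  then have "\<forall>\<^sub>F p in at (x, y) within {x..} \<times> {y..}. (case p of (a, b) \<Rightarrow> L a b) < c"
    using c by (rule order_tendstoD)
  then obtain S where S: "open S" "(x, y) \<in> S"
    "\<And>p. p \<in> S \<Longrightarrow> p \<noteq> (x, y) \<Longrightarrow> p \<in> {x..} \<times> {y..} \<Longrightarrow> (case p of (a, b) \<Rightarrow> L a b) < c"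
    unfolding eventually_at_topological by metis
  obtain A B where AB: "open A" "open B" "(x, y) \<in> A \<times> B" "A \<times> B \<subseteq> S"
    using open_prod_elim[OF S(1,2)] by metis
  obtain b where b: "b > x" "{x..<b} \<subseteq> A" using open_right[OF AB(1) _ xc] AB(3) by auto
  obtain t where t: "x < t" "t < b" using dense[OF b(1)] by blast
  have "t \<in> A" using b(2) t by auto
  then have "(t, y) \<in> S" using AB(3,4) by auto
  then have "L t y < c" using S(3)[of "(t, y)"] t by auto
  then show ?thesis using t by blast
qed

context
  fixes T L
  assumes T: "left_continuous_t_norm T" and L: "right_continuous_t_conorm L"
begin

lemma tn: "t_norm T" and tc: "t_conorm L"
  using T L by (auto simp: left_continuous_t_norm_def right_continuous_t_conorm_def)

lemma T_range:
  assumes "f \<in> Delta_plus" "g \<in> Delta_plus"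
  shows "0 \<le> T (f r) (g s)" "T (f r) (g s) \<le> 1"
  using t_normD(1)[OF tn, of "f r" "g s"] Delta_plusD(1,2)[OF assms(1)] Delta_plusD(1,2)[OF assms(2)]
  by auto

lemma step_bounds:
  assumes "f \<in> Delta_plus" "g \<in> Delta_plus"
  shows "0 \<le> step (L r s) (T (f r) (g s)) x" "step (L r s) (T (f r) (g s)) x \<le> 1"
  using T_range[OF assms] by (auto simp: step_def)

lemma tensor_bdd:
  assumes "f \<in> Delta_plus" "g \<in> Delta_plus"
  shows "bdd_above (range (\<lambda>(r, s). step (L r s) (T (f r) (g s)) x))"
  using step_bounds[OF assms] by (auto intro!: bdd_aboveI[where M = 1])

lemma less_tensor:
  assumes "f \<in> Delta_plus" "g \<in> Delta_plus" "x < \<infinity>" "0 \<le> c"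
  shows "c < tensor L T f g x \<longleftrightarrow> (\<exists>r s. L r s < x \<and> c < T (f r) (g s))"
proof -
  have "c < tensor L T f g x \<longleftrightarrow> (\<exists>r s. c < step (L r s) (T (f r) (g s)) x)"
    unfolding tensor_def using less_cSUP_iff[OF _ tensor_bdd[OF assms(1,2)], of c x] by auto
  also have "\<dots> \<longleftrightarrow> (\<exists>r s. L r s < x \<and> c < T (f r) (g s))"
    using assms(3,4) by (auto simp: step_def split: if_splits)
  finally show ?thesis .
qed

lemma tensor_top: "tensor L T f g \<infinity> = 1"
  by (simp add: tensor_def step_def case_prod_unfold)

lemma tensor_ge:
  assumes "f \<in> Delta_plus" "g \<in> Delta_plus"
  shows "step (L r s) (T (f r) (g s)) x \<le> tensor L T f g x"
  unfolding tensor_def using cSUP_upper[OF UNIV_I tensor_bdd[OF assms, of x], of "(r, s)"] by simp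

lemma tensor_range:
  assumes "f \<in> Delta_plus" "g \<in> Delta_plus"
  shows "0 \<le> tensor L T f g x" "tensor L T f g x \<le> 1"
proof -
  show "0 \<le> tensor L T f g x"
    using order_trans[OF step_bounds(1)[OF assms] tensor_ge[OF assms]] by blast
  show "tensor L T f g x \<le> 1"
    unfolding tensor_def by (rule cSUP_least) (auto intro: step_bounds[OF assms])
qed

lemma tensor_in_Delta_plus:
  assumes f: "f \<in> Delta_plus" and g: "g \<in> Delta_plus"
  shows "tensor L T f g \<in> Delta_plus"
proof (rule Delta_plusI)
  show "tensor L T f g x \<in> {0..1}" for x using tensor_range[OF f g] by simp
  show "mono (tensor L T f g)"
    unfolding tensor_def
  proof (intro monoI cSUP_mono)
    fix x y :: ennreal and p :: "ennreal \<times> ennreal" assume "x \<le> y"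
    obtain r s where p: "p = (r, s)" by fastforce
    have "step (L r s) (T (f r) (g s)) x \<le> step (L r s) (T (f r) (g s)) y"
      using step_in_Delta_plus T_range[OF f g, of r s] \<open>x \<le> y\<close> Delta_plusD(3) by simp
    then show "\<exists>m\<in>UNIV. (case p of (r, s) \<Rightarrow> step (L r s) (T (f r) (g s)) x)
        \<le> (case m of (r, s) \<Rightarrow> step (L r s) (T (f r) (g s)) y)" by (auto simp: p)
  qed (use tensor_bdd[OF f g] in auto)
  show "tensor L T f g 0 = 0"
    using less_tensor[OF f g, of 0 0] tensor_range[OF f g, of 0] by auto
  show "tensor L T f g \<infinity> = 1" by (rule tensor_top)
  fix x :: ennreal and c :: real assume x: "0 < x" "x < \<infinity>" and c: "(0::real) \<le> c" "c < tensor L T f g x"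
  then obtain r s where rs: "L r s < x" "c < T (f r) (g s)" using less_tensor[OF f g] by blast
  obtain y where "L r s < y" "y < x" using dense[OF rs(1)] by blast
  then show "\<exists>y<x. c < tensor L T f g y"
    using less_tensor[OF f g, of y c] rs x c by (meson less_trans)
qed

lemma tensor_lub:
  assumes f: "f \<in> Delta_plus" and g: "g \<in> Delta_plus"
  shows "tensor L T f g \<in> Delta_plus"
    and "step (L r s) (T (f r) (g s)) \<in> Delta_plus"
    and "step (L r s) (T (f r) (g s)) \<le> tensor L T f g"
    and "(\<And>r s. step (L r s) (T (f r) (g s)) \<le> h) \<Longrightarrow> tensor L T f g \<le> h"
proof -
  show "tensor L T f g \<in> Delta_plus" by (rule tensor_in_Delta_plus[OF f g])
  show "step (L r s) (T (f r) (g s)) \<in> Delta_plus"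
    using T_range[OF f g] by (simp add: step_in_Delta_plus)
  show "step (L r s) (T (f r) (g s)) \<le> tensor L T f g"
    using tensor_ge[OF f g] by (simp add: le_fun_def)
  show "tensor L T f g \<le> h" if "\<And>r s. step (L r s) (T (f r) (g s)) \<le> h"
    unfolding tensor_def le_fun_def using that
    by (auto intro!: cSUP_least simp: le_fun_def)
qed

lemma tensor_eqI:
  assumes "f \<in> Delta_plus" "g \<in> Delta_plus" "h \<in> Delta_plus"
    and "\<And>x c. x < \<infinity> \<Longrightarrow> 0 \<le> c \<Longrightarrow>
      (\<exists>r s. L r s < x \<and> c < T (f r) (g s)) \<longleftrightarrow> c < h x"
  shows "tensor L T f g = h"
proof
  fix x
  show "tensor L T f g x = h x"
  proof (cases "x = \<infinity>")
    case True
    then show ?thesis using tensor_top Delta_plusD(5)[OF assms(3)] by metis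
  next
    case False
    then have x: "x < \<infinity>" by (simp add: less_top)
    have "c < tensor L T f g x \<longleftrightarrow> c < h x" if "0 \<le> c" for c
      using less_tensor[OF assms(1,2) x that] assms(4)[OF x that] by simp
    then show ?thesis
      using tensor_range(1)[OF assms(1,2), of x] Delta_plusD(1)[OF assms(3), of x]
      by (meson less_irrefl linorder_less_linear)
  qed
qed

lemma tensor_commute:
  assumes f: "f \<in> Delta_plus" and g: "g \<in> Delta_plus"
  shows "tensor L T f g = tensor L T g f"
proof (rule tensor_eqI[OF f g tensor_in_Delta_plus[OF g f]])
  fix x :: ennreal and c :: real assume x: "x < \<infinity>" and c: "(0::real) \<le> c"
  have "T (f r) (g s) = T (g s) (f r)" for r s
    using t_normD(2)[OF tn] Delta_plusD(1,2)[OF f] Delta_plusD(1,2)[OF g] by simp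
  then show "(\<exists>r s. L r s < x \<and> c < T (f r) (g s)) \<longleftrightarrow> c < tensor L T g f x"
    using less_tensor[OF g f x c] t_conormD(2)[OF tc] by metis
qed

lemma less_tensor_left:
  assumes f: "f \<in> Delta_plus" and g: "g \<in> Delta_plus" and h: "h \<in> Delta_plus"
    and x: "x < \<infinity>" and c: "0 \<le> c"
  shows "c < tensor L T (tensor L T f g) h x \<longleftrightarrow>
    (\<exists>r s u. L (L r s) u < x \<and> c < T (T (f r) (g s)) (h u))"
proof -
  have fg: "tensor L T f g \<in> Delta_plus" by (rule tensor_in_Delta_plus[OF f g])
  have "(\<exists>t u. L t u < x \<and> c < T (tensor L T f g t) (h u)) \<longleftrightarrow>
    (\<exists>r s u. L (L r s) u < x \<and> c < T (T (f r) (g s)) (h u))"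
  proof (intro iffI; elim exE conjE)
    fix t u assume *: "L t u < x" "c < T (tensor L T f g t) (h u)"
    have t: "t < \<infinity>" using t_conorm_ge(1)[OF tc, of t u] * x by simp
    obtain d where d: "0 \<le> d" "d < tensor L T f g t" "c < T d (h u)"
      using t_norm_left[OF T, of "tensor L T f g t" "h u" c] * c
        Delta_plusD(1,2)[OF fg] Delta_plusD(1,2)[OF h] by auto
    obtain r s where rs: "L r s < t" "d < T (f r) (g s)" using less_tensor[OF f g t d(1)] d by blast
    have "T d (h u) \<le> T (T (f r) (g s)) (h u)"
      using t_normD(5)[OF tn, of d "h u" "T (f r) (g s)"] d rs T_range[OF f g, of r s]
        Delta_plusD(1,2)[OF h] by auto
    moreover have "L (L r s) u \<le> L t u" using t_conormD(5)[OF tc] rs by simp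
    ultimately have "L (L r s) u < x" "c < T (T (f r) (g s)) (h u)" using * d by auto
    then show "\<exists>r s u. L (L r s) u < x \<and> c < T (T (f r) (g s)) (h u)" by blast
  next
    fix r s u assume *: "L (L r s) u < x" "c < T (T (f r) (g s)) (h u)"
    obtain t where t: "L r s < t" "L t u < x" using t_conorm_right[OF L *(1)] by blast
    have "t < \<infinity>" using t_conorm_ge(1)[OF tc, of t u] t x by simp
    then have "T (f r) (g s) \<le> tensor L T f g t"
      using tensor_ge[OF f g, of r s t] t by (auto simp: step_def split: if_splits)
    then have "T (T (f r) (g s)) (h u) \<le> T (tensor L T f g t) (h u)"
      using t_normD(5)[OF tn, of "T (f r) (g s)" "h u" "tensor L T f g t"] T_range[OF f g, of r s]
        Delta_plusD(1,2)[OF h] tensor_range[OF f g, of t] by auto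
    then show "\<exists>t u. L t u < x \<and> c < T (tensor L T f g t) (h u)" using t * by force
  qed
  then show ?thesis using less_tensor[OF fg h x c] by simp
qed

lemma tensor_assoc:
  assumes f: "f \<in> Delta_plus" and g: "g \<in> Delta_plus" and h: "h \<in> Delta_plus"
  shows "tensor L T (tensor L T f g) h = tensor L T f (tensor L T g h)"
proof -
  have fg: "tensor L T f g \<in> Delta_plus" by (rule tensor_in_Delta_plus[OF f g])
  have gh: "tensor L T g h \<in> Delta_plus" by (rule tensor_in_Delta_plus[OF g h])
  have eq: "T (T (f r) (g s)) (h u) = T (T (g s) (h u)) (f r)" for r s u
    using t_normD(2,7)[OF tn] t_normD(1)[OF tn, of "g s" "h u"]
      Delta_plusD(1,2)[OF f] Delta_plusD(1,2)[OF g] Delta_plusD(1,2)[OF h] by simp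
  have eqL: "L (L r s) u = L (L s u) r" for r s u
    using t_conormD(1,2)[OF tc] by metis
  have "tensor L T (tensor L T f g) h = tensor L T (tensor L T g h) f"
  proof (rule tensor_eqI[OF fg h tensor_in_Delta_plus[OF gh f]])
    fix x :: ennreal and c :: real assume x: "x < \<infinity>" and c: "(0::real) \<le> c"
    show "(\<exists>r s. L r s < x \<and> c < T (tensor L T f g r) (h s)) \<longleftrightarrow>
        c < tensor L T (tensor L T g h) f x"
      unfolding less_tensor[OF fg h x c, symmetric]
        less_tensor_left[OF f g h x c] less_tensor_left[OF g h f x c]
      by (metis eq eqL)
  qed
  also have "\<dots> = tensor L T f (tensor L T g h)" by (rule tensor_commute[OF gh f])
  finally show ?thesis .
qed

lemma tensor_one:
  assumes f: "f \<in> Delta_plus"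
  shows "tensor L T (step 0 1) f = f"
proof (rule tensor_eqI[OF _ f f])
  show e: "step 0 1 \<in> Delta_plus" by (simp add: step_in_Delta_plus)
  fix x :: ennreal and c :: real assume x: "x < \<infinity>" and c: "(0::real) \<le> c"
  show "(\<exists>r s. L r s < x \<and> c < T (step 0 1 r) (f s)) \<longleftrightarrow> c < f x"
  proof (intro iffI; (elim exE conjE)?)
    fix r s assume *: "L r s < x" "c < T (step 0 1 r) (f s)"
    have "T (step 0 1 r) (f s) \<le> T 1 (f s)"
      using t_normD(5)[OF tn, of "step 0 1 r" "f s" 1] Delta_plusD(1,2)[OF e, of r]
        Delta_plusD(1,2)[OF f, of s] by auto
    also have "\<dots> = f s" using t_normD(4)[OF tn, of "f s" 1] Delta_plusD(1,2)[OF f, of s] by auto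
    also have "\<dots> \<le> f x"
      using Delta_plusD(3)[OF f, of s x] t_conorm_ge(2)[OF tc, of s r] * by simp
    finally show "c < f x" using * by simp
  next
    assume "c < f x"
    then obtain s where s: "s < x" "c < f s" using Delta_plus_left[OF f x c] by blast
    obtain r where r: "0 < r" "L r s < x"
      using t_conorm_right[OF L, of 0 s x] s t_conormD(4)[OF tc] by auto
    have "step 0 1 r = 1" using r by (simp add: step_def)
    then have "T (step 0 1 r) (f s) = f s"
      using t_normD(4)[OF tn, of "f s" 1] Delta_plusD(1,2)[OF f, of s] by auto
    then show "\<exists>r s. L r s < x \<and> c < T (step 0 1 r) (f s)" using r s by metis
  qed
qed

lemma Delta_monoid_comm_monoid: "comm_monoid (Delta_monoid L T)"
  by (rule comm_monoidI)
     (auto simp: Delta_monoid_def tensor_in_Delta_plus step_in_Delta_plus tensor_assoc tensor_one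
       intro: tensor_commute)

lemma tensor_step:
  assumes p: "p \<in> {0..1}" and q: "q \<in> {0..1}"
  shows "tensor L T (step r p) (step s q) = step (L r s) (T p q)"
proof (rule tensor_eqI)
  show sp: "step r p \<in> Delta_plus" and sq: "step s q \<in> Delta_plus"
    and "step (L r s) (T p q) \<in> Delta_plus"
    using p q t_normD(1)[OF tn p q] by (auto intro: step_in_Delta_plus)
  fix x :: ennreal and c :: real assume x: "x < \<infinity>" and c: "(0::real) \<le> c"
  show "(\<exists>t u. L t u < x \<and> c < T (step r p t) (step s q u)) \<longleftrightarrow> c < step (L r s) (T p q) x"
  proof (intro iffI; (elim exE conjE)?)
    fix t u assume *: "L t u < x" "c < T (step r p t) (step s q u)"
    have fin: "t < \<infinity>" "u < \<infinity>"
      using t_conorm_ge[OF tc, where x = t and y = u] * x by auto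
    have r: "r < t" using * c fin t_norm_0(2)[OF tn, of "step s q u"] Delta_plusD(1,2)[OF sq, of u]
      by (auto simp: step_def[of r] split: if_splits)
    have s: "s < u" using * c fin t_norm_0(1)[OF tn, of "step r p t"] Delta_plusD(1,2)[OF sp, of t]
      by (auto simp: step_def[of s] split: if_splits)
    have "L r s \<le> L t u"
      using order_trans[OF t_conormD(5)[OF tc less_imp_le[OF r]] t_conormD(6)[OF tc less_imp_le[OF s]]] .
    then show "c < step (L r s) (T p q) x" using * fin r s x by (auto simp: step_def split: if_splits)
  next
    assume "c < step (L r s) (T p q) x"
    then have *: "L r s < x" "c < T p q" using x c by (auto simp: step_def split: if_splits)
    obtain t where t: "r < t" "L t s < x" using t_conorm_right[OF L *(1)] by blast
    obtain u where u: "s < u" "L u t < x"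
      using t_conorm_right[OF L, of s t x] t(2) t_conormD(2)[OF tc, of t s] by auto
    have fin: "t < \<infinity>" "u < \<infinity>"
      using t_conorm_ge[OF tc, where x = u and y = t] u x by auto
    have "L t u < x" using u t_conormD(2)[OF tc, of t u] by simp
    moreover have "c < T (step r p t) (step s q u)"
      using fin[THEN less_imp_neq] t u * by (simp add: step_def)
    ultimately show "\<exists>t u. L t u < x \<and> c < T (step r p t) (step s q u)" by blast
  qed
qed

lemma tensor_SUP:
  assumes F: "F \<noteq> {}" "F \<subseteq> Delta_plus" and g: "g \<in> Delta_plus"
  shows "(\<lambda>x. SUP f\<in>F. f x) \<in> Delta_plus"
    and "tensor L T (\<lambda>x. SUP f\<in>F. f x) g = (\<lambda>x. SUP f\<in>F. tensor L T f g x)"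
proof -
  have SUP_in: "(\<lambda>x. SUP f\<in>G. f x) \<in> Delta_plus" if G: "G \<noteq> {}" "G \<subseteq> Delta_plus" for G
  proof (rule Delta_plusI)
    have D: "0 \<le> f x" "f x \<le> 1" "f 0 = 0" "f \<infinity> = 1" if "f \<in> G" for f x
      using G(2) that Delta_plusD(1,2,4,5)[of f] by auto
    have bdd: "bdd_above ((\<lambda>f. f x) ` G)" for x
      using D(2) by (auto intro!: bdd_aboveI[where M = 1])
    obtain f0 where f0: "f0 \<in> G" using G(1) by blast
    show "(SUP f\<in>G. f x) \<in> {0..1}" for x
    proof -
      have "0 \<le> (SUP f\<in>G. f x)" using cSUP_upper[OF f0 bdd[of x]] D(1)[OF f0, of x] by simp
      moreover have "(SUP f\<in>G. f x) \<le> 1" using G(1) D(2) by (intro cSUP_least)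
      ultimately show ?thesis by simp
    qed
    show "mono (\<lambda>x. SUP f\<in>G. f x)"
    proof (rule monoI)
      fix x y :: ennreal assume "x \<le> y"
      then have "\<And>f. f \<in> G \<Longrightarrow> f x \<le> f y" using G(2) Delta_plusD(3) by blast
      then show "(SUP f\<in>G. f x) \<le> (SUP f\<in>G. f y)" using bdd[of y] by (intro cSUP_mono G(1)) auto
    qed
    have "(\<lambda>f. f 0) ` G = {0}" "(\<lambda>f. f \<infinity>) ` G = {1}" using D(3,4) f0 by force+
    then show "(SUP f\<in>G. f 0) = 0" "(SUP f\<in>G. f \<infinity>) = 1" by (metis cSup_singleton)+
    fix x :: ennreal and c :: real
    assume x: "x < \<infinity>" and c: "0 \<le> c" "c < (SUP f\<in>G. f x)"
    then obtain f where f: "f \<in> G" "c < f x" using less_cSUP_iff[OF G(1) bdd] by blast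
    have "f \<in> Delta_plus" using f G(2) by blast
    then obtain y where y: "y < x" "c < f y" using Delta_plus_left x c(1) f(2) by blast
    have "c < (SUP f\<in>G. f y)" using less_cSUP_iff[OF G(1) bdd] f(1) y(2) by blast
    then show "\<exists>y<x. c < (SUP f\<in>G. f y)" using y(1) by blast
  qed
  show S: "(\<lambda>x. SUP f\<in>F. f x) \<in> Delta_plus" by (rule SUP_in[OF F])
  let ?G = "(\<lambda>f. tensor L T f g) ` F"
  have "?G \<noteq> {}" "?G \<subseteq> Delta_plus" using F g tensor_in_Delta_plus by auto
  then have TS: "(\<lambda>x. SUP f\<in>F. tensor L T f g x) \<in> Delta_plus"
    using SUP_in[of ?G] by (simp add: image_image)
  have bddF: "bdd_above ((\<lambda>f. f r) ` F)" for r
    using F(2) Delta_plusD(2) by (intro bdd_aboveI[where M = 1]) blast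
  have bddT: "bdd_above ((\<lambda>f. tensor L T f g x) ` F)" for x
    using F(2) tensor_range(2)[OF _ g] by (intro bdd_aboveI[where M = 1]) blast
  show "tensor L T (\<lambda>x. SUP f\<in>F. f x) g = (\<lambda>x. SUP f\<in>F. tensor L T f g x)"
  proof (rule tensor_eqI[OF S g TS])
    fix x :: ennreal and c :: real assume x: "x < \<infinity>" and c: "0 \<le> c"
    have gs: "g s \<in> {0..1}" for s using Delta_plusD(1,2)[OF g] by simp
    have fr: "f r \<in> {0..1}" if "f \<in> F" for f r using Delta_plusD(1,2)[of f] F(2) that by auto
    have Sr: "(SUP f\<in>F. f r) \<in> {0..1}" for r using Delta_plusD(1,2)[OF S] by simp
    have *: "c < T (SUP f\<in>F. f r) (g s) \<longleftrightarrow> (\<exists>f\<in>F. c < T (f r) (g s))" for r s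
    proof
      assume "c < T (SUP f\<in>F. f r) (g s)"
      then obtain d where d: "0 \<le> d" "d < (SUP f\<in>F. f r)" "c < T d (g s)"
        using t_norm_left[OF T Sr gs c] by blast
      then obtain f where f: "f \<in> F" "d < f r" using less_cSUP_iff[OF F(1) bddF] by blast
      have "T d (g s) \<le> T (f r) (g s)"
        using t_normD(5)[OF tn _ gs fr[OF f(1)], of d r s] d(1) f(2) fr[OF f(1), of r] by simp
      then show "\<exists>f\<in>F. c < T (f r) (g s)" using less_le_trans[OF d(3)] f(1) by blast
    next
      assume "\<exists>f\<in>F. c < T (f r) (g s)"
      then obtain f where f: "f \<in> F" "c < T (f r) (g s)" by blast
      have "T (f r) (g s) \<le> T (SUP f\<in>F. f r) (g s)"
        using t_normD(5)[OF tn fr[OF f(1)] gs Sr] cSUP_upper[OF f(1) bddF] by simp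
      then show "c < T (SUP f\<in>F. f r) (g s)" using f(2) by simp
    qed
    have **: "c < tensor L T f g x \<longleftrightarrow> (\<exists>r s. L r s < x \<and> c < T (f r) (g s))" if "f \<in> F" for f
      using less_tensor[OF _ g x c] F(2) that by blast
    show "(\<exists>r s. L r s < x \<and> c < T (SUP f\<in>F. f r) (g s)) \<longleftrightarrow>
        c < (SUP f\<in>F. tensor L T f g x)"
      unfolding less_cSUP_iff[OF F(1) bddT] * using ** by blast
  qed
qed

text \<open>The empty supremum: \<open>step \<infinity> 0\<close> is the least element of \<open>Delta_plus\<close>.\<close>

lemma tensor_bottom:
  assumes g: "g \<in> Delta_plus"
  shows "step \<infinity> 0 \<le> g" and "tensor L T (step \<infinity> 0) g = step \<infinity> 0"
proof -
  have bot: "step \<infinity> 0 \<le> h" if "h \<in> Delta_plus" for h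
    using Delta_plusD(1,5)[OF that] by (auto simp: le_fun_def step_def)
  show "step \<infinity> 0 \<le> g" by (rule bot[OF g])
  have e: "step \<infinity> 0 \<in> Delta_plus" by (simp add: step_in_Delta_plus)
  show "tensor L T (step \<infinity> 0) g = step \<infinity> 0"
  proof (rule antisym)
    show "step \<infinity> 0 \<le> tensor L T (step \<infinity> 0) g" by (rule bot[OF tensor_in_Delta_plus[OF e g]])
    show "tensor L T (step \<infinity> 0) g \<le> step \<infinity> 0"
    proof (rule tensor_lub(4)[OF e g], rule le_funI)
      fix r s x
      have "T 0 (g s) = 0" using t_norm_0(2)[OF tn, of "g s"] Delta_plusD(1,2)[OF g] by simp
      moreover have "L \<infinity> s = \<infinity>" using t_conorm_ge(1)[OF tc, of \<infinity> s] by (simp add: top_unique)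
      ultimately show "step (L r s) (T (step \<infinity> 0 r) (g s)) x \<le> step \<infinity> 0 x"
        by (cases "r = \<infinity>") (auto simp: step_def)
    qed
  qed
qed

end

end

theory Submission
  imports Defs
begin

text \<open>
  Non-defectiveness says that \<open>f\<close> exceeds every level below \<open>1\<close> at some finite point, so
  the question is whether \<open>L \<otimes> T\<close> preserves the property of exceeding levels at finite points.

  The t-norm never obstructs this: by left continuity, \<open>T 1 1 = 1\<close> lets every level below
  \<open>1\<close> be beaten by \<open>T a b\<close> with \<open>a, b < 1\<close>. If \<open>f\<close> exceeds \<open>a\<close> at a finite \<open>r\<close> and
  \<open>g\<close> exceeds \<open>b\<close> at a finite \<open>s\<close>, then the product exceeds the level everywhere beyond
  \<open>L r s\<close>. The only thing that can go wrong is \<open>L r s = \<infinity>\<close>, which leaves no finite point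
  beyond \<open>L r s\<close>. Absence of zero divisors is exactly what excludes this
  (lemma \<open>tensor_in_D_plus\<close>).

  Conversely, a pair of finite zero divisors \<open>r, s\<close> yields the product \<open>\<epsilon>(\<infinity>, 1)\<close> of the
  non-defective functions \<open>\<epsilon>(r, 1)\<close> and \<open>\<epsilon>(s, 1)\<close>, and \<open>\<epsilon>(\<infinity>, 1)\<close> vanishes at
  all finite points (lemma \<open>step_one_in_D_plus_iff\<close>). This lemma at \<open>r = 0\<close> also shows that
  the identity \<open>\<epsilon>(0, 1)\<close> is non-defective, and closure under the product then makes
  \<open>D_plus\<close> a submonoid.
\<close>

text \<open>Restricting to levels \<open>0 \<le> c\<close> is harmless because \<open>f\<close> takes values in the unit
  interval, and it matches the range in which \<open>less_tensor\<close> describes the levels of a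
  product.\<close>

lemma D_plus_iff_levels:
  assumes f: "f \<in> Delta_plus"
  shows "f \<in> D_plus \<longleftrightarrow> (\<forall>c. 0 \<le> c \<and> c < 1 \<longrightarrow> (\<exists>x<\<infinity>. c < f x))"
proof -
  let ?S = "SUP x\<in>{..<\<infinity>}. f x"
  have ne: "{..<\<infinity>::ennreal} \<noteq> {}"
    by (metis ennreal_zero_less_top infinity_ennreal_def lessThan_iff empty_iff)
  have bdd: "bdd_above (f ` {..<\<infinity>})"
    using Delta_plusD(2)[OF f] by (auto intro!: bdd_aboveI[where M = 1])
  have le1: "?S \<le> 1"
    using ne Delta_plusD(2)[OF f] by (intro cSUP_least)
  have ge0: "0 \<le> ?S"
  proof -
    have "f 0 \<le> ?S" by (rule cSUP_upper[OF _ bdd]) simp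
    then show ?thesis using Delta_plusD(4)[OF f] by simp
  qed
  have level: "c < ?S \<longleftrightarrow> (\<exists>x<\<infinity>. c < f x)" for c
    using less_cSUP_iff[OF ne bdd, of c] by auto
  have "?S = 1 \<longleftrightarrow> (\<forall>c. 0 \<le> c \<and> c < 1 \<longrightarrow> c < ?S)"
    using le1 ge0 by (metis less_irrefl order_le_less)
  also have "\<dots> \<longleftrightarrow> (\<forall>c. 0 \<le> c \<and> c < 1 \<longrightarrow> (\<exists>x<\<infinity>. c < f x))"
    unfolding level ..
  finally show ?thesis using f unfolding D_plus_def by blast
qed

lemma step_one_in_D_plus_iff: "step r 1 \<in> D_plus \<longleftrightarrow> r \<noteq> \<infinity>"
proof -
  have S: "step r 1 \<in> Delta_plus" by (simp add: step_in_Delta_plus)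
  have above: "(\<exists>x<\<infinity>. c < step r 1 x) \<longleftrightarrow> r \<noteq> \<infinity>" if c: "0 \<le> c" "c < 1" for c
  proof
    assume "\<exists>x<\<infinity>. c < step r 1 x"
    then show "r \<noteq> \<infinity>" using c(1) by (auto simp: step_def split: if_splits)
  next
    assume "r \<noteq> \<infinity>"
    then have "r < \<infinity>" by (simp add: less_top)
    then obtain x where x: "r < x" "x < \<infinity>" using dense by blast
    then have "c < step r 1 x" using c(2) by (simp add: step_def)
    then show "\<exists>x<\<infinity>. c < step r 1 x" using x by blast
  qed
  have "step r 1 \<in> D_plus \<longleftrightarrow> (\<forall>c::real. 0 \<le> c \<and> c < 1 \<longrightarrow> r \<noteq> \<infinity>)"
    unfolding D_plus_iff_levels[OF S] using above by simp
  also have "\<dots> \<longleftrightarrow> r \<noteq> \<infinity>" using zero_less_one order_refl by blast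
  finally show ?thesis .
qed

text \<open>One-sided left continuity is applied twice, lowering first one argument of
  \<open>T 1 1 = 1\<close> and then the other.\<close>

lemma t_norm_exceeds_level_below_one:
  assumes T: "left_continuous_t_norm T" and c: "0 \<le> c" "c < 1"
  obtains a b where "0 \<le> a" "a < 1" "0 \<le> b" "b < 1" "c < T a b"
proof -
  have tn: "t_norm T" using T by (simp add: left_continuous_t_norm_def)
  have "c < T 1 1" using t_normD(3)[OF tn, of 1 1] c by simp
  then obtain a where a: "0 \<le> a" "a < 1" "c < T a 1"
    using t_norm_left[OF T, of 1 1 c] c(1) by auto
  have "c < T 1 a" using t_normD(2)[OF tn, of 1 a] a by simp
  then obtain b where b: "0 \<le> b" "b < 1" "c < T b a"
    using t_norm_left[OF T, of 1 a c] a c(1) by auto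
  show thesis using that[OF b(1,2) a(1,2) b(3)] .
qed

lemma tensor_in_D_plus:
  assumes T: "left_continuous_t_norm T" and L: "right_continuous_t_conorm L"
    and no_zero_div: "\<And>x y. L x y = \<infinity> \<Longrightarrow> x = \<infinity> \<or> y = \<infinity>"
    and f: "f \<in> D_plus" and g: "g \<in> D_plus"
  shows "tensor L T f g \<in> D_plus"
proof -
  have tn: "t_norm T" using T by (simp add: left_continuous_t_norm_def)
  have fD: "f \<in> Delta_plus" and gD: "g \<in> Delta_plus" using f g by (auto simp: D_plus_def)
  have "\<exists>x<\<infinity>. c < tensor L T f g x" if c: "0 \<le> c" "c < 1" for c
  proof -
    obtain a b where ab: "0 \<le> a" "a < 1" "0 \<le> b" "b < 1" "c < T a b"
      using t_norm_exceeds_level_below_one[OF T c] .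
    obtain r where r: "r < \<infinity>" "a < f r" using f ab D_plus_iff_levels[OF fD] by blast
    obtain s where s: "s < \<infinity>" "b < g s" using g ab D_plus_iff_levels[OF gD] by blast
    have "T a b \<le> T (f r) b"
      using t_normD(5)[OF tn, of a b "f r"] ab r Delta_plusD(1,2)[OF fD, of r] by auto
    also have "\<dots> \<le> T (f r) (g s)"
      using t_normD(6)[OF tn, of "f r" b "g s"] ab s
        Delta_plusD(1,2)[OF fD, of r] Delta_plusD(1,2)[OF gD, of s] by auto
    finally have "c < T (f r) (g s)" using ab(5) by simp
    moreover have "L r s < \<infinity>"
      using no_zero_div[of r s] r(1) s(1) by (metis infinity_ennreal_def less_irrefl less_top)
    then obtain x where x: "L r s < x" "x < \<infinity>" using dense by blast
    ultimately have "c < tensor L T f g x"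
      using less_tensor[OF T L fD gD x(2) c(1)] by blast
    then show ?thesis using x(2) by blast
  qed
  then show ?thesis
    using D_plus_iff_levels[OF tensor_in_Delta_plus[OF T L fD gD]] by blast
qed

theorem theorem4p1:
  fixes T :: "real \<Rightarrow> real \<Rightarrow> real"
    and L :: "ennreal \<Rightarrow> ennreal \<Rightarrow> ennreal"
  assumes "left_continuous_t_norm T"
    and "right_continuous_t_conorm L"
  shows "((\<forall>f\<in>D_plus. \<forall>g\<in>D_plus. tensor L T f g \<in> D_plus) \<longleftrightarrow>
          (\<forall>x y. L x y = \<infinity> \<longrightarrow> x = \<infinity> \<or> y = \<infinity>)) \<and>
         ((\<forall>x y. L x y = \<infinity> \<longrightarrow> x = \<infinity> \<or> y = \<infinity>) \<longrightarrow>
          submonoid D_plus (Delta_monoid L T))"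
proof -
  have closed: "\<forall>f\<in>D_plus. \<forall>g\<in>D_plus. tensor L T f g \<in> D_plus"
    if "\<forall>x y. L x y = \<infinity> \<longrightarrow> x = \<infinity> \<or> y = \<infinity>"
    using tensor_in_D_plus[OF assms] that by blast
  have no_zero_div: "x = \<infinity> \<or> y = \<infinity>"
    if cl: "\<forall>f\<in>D_plus. \<forall>g\<in>D_plus. tensor L T f g \<in> D_plus" and "L x y = \<infinity>" for x y
  proof (rule ccontr)
    assume "\<not> (x = \<infinity> \<or> y = \<infinity>)"
    then have "tensor L T (step x 1) (step y 1) \<in> D_plus"
      using cl step_one_in_D_plus_iff by blast
    moreover have "T 1 1 = 1"
      using t_normD(3)[of T 1 1] assms(1) by (simp add: left_continuous_t_norm_def)
    then have "tensor L T (step x 1) (step y 1) = step \<infinity> 1"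
      using tensor_step[OF assms, of 1 1 x y] \<open>L x y = \<infinity>\<close> by simp
    ultimately show False using step_one_in_D_plus_iff[of \<infinity>] by simp
  qed
  have "submonoid D_plus (Delta_monoid L T)"
    if "\<forall>x y. L x y = \<infinity> \<longrightarrow> x = \<infinity> \<or> y = \<infinity>"
    using closed[OF that] step_one_in_D_plus_iff[of 0]
    by (auto simp: submonoid_def Delta_monoid_def D_plus_def)
  then show ?thesis using closed no_zero_div by blast
qed

end
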